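(* Let $(M,g_{ab})$ be a static spacetime with (hypersurface-orthogonal, stationary) Killing vector field $k^a$, containing a Killing horizon $H[k]$ generated by $k^a$. Let $F_{ab}$ be an electromagnetic field (a solution of Maxwell's equations $\mathrm{d}F = 4\pi\,{*J_{\mathrm m}}$, $\mathrm{d}{*F} = 4\pi\,{*J_{\mathrm e}}$ with electric current $J_{\mathrm e}$ and magnetic current $J_{\mathrm m}$) which is invariant under $k^a$, i.e. $\mathcal{L}_k F = 0$, is nonsingular on $H[k]$, and satisfies one of the two staticity conditions $$F\wedge k = 0 \qquad\text{or}\qquad {*F}\wedge k = 0 .$$ Let $\Phi$ and $\Psi$ be the electric and magnetic scalar potentials with respect to $k^a$, i.e. functions on an open neighbourhood of $H[k]$ satisfying $\mathrm{d}\Phi = -i_kF$ and $\mathrm{d}\Psi = i_k{*F}$. Then $\Phi$ and $\Psi$ are constant on each connected component of $H[k]$.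
   Context: Conventions: spacetimes are 4-dimensional, connected, (oriented) smooth Lorentzian manifolds with signature $(-,+,+,+)$; no gravitational field equation is assumed. Vectors and 1-forms are identified via the metric, so $k$ in $F\wedge k$ denotes the 1-form $k_a$. The Hodge dual of a $p$-form is $( *\omega)_{a_{p+1}\cdots a_4} = \frac{1}{p!}\,\omega_{a_1\cdots a_p}\,\epsilon^{a_1\cdots a_p}{}_{a_{p+1}\cdots a_4}$, and $i_X$ denotes contraction of a vector $X^a$ with the first slot of a form. The electromagnetic field is a 2-form $F_{ab}$; the currents $J_{\mathrm e}$, $J_{\mathrm m}$ are 1-forms (or vectors). Static spacetime: there is a stationary Killing vector field $k^a$ (timelike at least in an exterior region) which is hypersurface orthogonal, i.e. its twist $\omega = -{*(k\wedge \mathrm{d}k)}$ vanishes. Killing horizon $H[k]$: a null hypersurface to which the Killing field $k^a$ is normal at every point (so $k^ak_a=0$ on $H[k]$; $k^a$ may vanish at some points of it). "Nonsingular on $H[k]$" means that $F_{ab}$ is a regular (smooth) tensor field at the points of $H[k]$. *)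

theory Defs
  imports "HOL-Analysis.Analysis"
begin

section \<open>Smooth maps\<close>

fun higher_differentiable_on ::
  "'a::real_normed_vector set \<Rightarrow> ('a \<Rightarrow> 'b::real_normed_vector) \<Rightarrow> nat \<Rightarrow> bool" where
  "higher_differentiable_on S f 0 \<longleftrightarrow> continuous_on S f"
| "higher_differentiable_on S f (Suc n) \<longleftrightarrow>
     (\<forall>x\<in>S. f differentiable (at x)) \<and>
     (\<forall>v. higher_differentiable_on S (\<lambda>x. frechet_derivative f (at x) v) n)"

text \<open>Only used on open sets \<open>S\<close>, where it means \<open>C\<^sup>\<infinity>\<close>.\<close>

definition smooth_on ::
  "'a::real_normed_vector set \<Rightarrow> ('a \<Rightarrow> 'b::real_normed_vector) \<Rightarrow> bool" where
  "smooth_on S f \<longleftrightarrow> (\<forall>n. higher_differentiable_on S f n)"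


section \<open>Oriented smooth 4-manifolds\<close>

text \<open>A chart is a pair of a domain and a coordinate map. Coordinates are indexed by the
  type \<open>4\<close>, whose elements are \<open>0, 1, 2, 3\<close>; the values of a coordinate map outside the
  domain are irrelevant. The underlying set of the manifold is the union of the domains of
  the charts of an atlas; it is an open subset of the ambient topological space.\<close>

type_synonym 'm chart = "'m set \<times> ('m \<Rightarrow> real^4)"

abbreviation chart_dom :: "'m chart \<Rightarrow> 'm set" where "chart_dom c \<equiv> fst c"
abbreviation coord :: "'m chart \<Rightarrow> 'm \<Rightarrow> real^4" where "coord c \<equiv> snd c"

definition chart_inv :: "'m chart \<Rightarrow> real^4 \<Rightarrow> 'm" where
  "chart_inv c = inv_into (chart_dom c) (coord c)"

definition is_chart :: "('m::topological_space) chart \<Rightarrow> bool" where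
  "is_chart c \<longleftrightarrow> open (chart_dom c) \<and> open (coord c ` chart_dom c) \<and>
     homeomorphism (chart_dom c) (coord c ` chart_dom c) (coord c) (chart_inv c)"

definition transition :: "'m chart \<Rightarrow> 'm chart \<Rightarrow> real^4 \<Rightarrow> real^4" where
  "transition c c' = coord c' \<circ> chart_inv c"

definition smoothly_compatible :: "'m chart \<Rightarrow> 'm chart \<Rightarrow> bool" where
  "smoothly_compatible c c' \<longleftrightarrow>
     smooth_on (coord c ` (chart_dom c \<inter> chart_dom c')) (transition c c') \<and>
     smooth_on (coord c' ` (chart_dom c \<inter> chart_dom c')) (transition c' c)"

text \<open>\<open>jacobian c c' p $ i $ j\<close> is the derivative at \<open>p\<close> of the \<open>i\<close>-th coordinate of \<open>c'\<close>
  with respect to the \<open>j\<close>-th coordinate of \<open>c\<close>.\<close>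

definition jacobian :: "'m chart \<Rightarrow> 'm chart \<Rightarrow> 'm \<Rightarrow> real^4^4" where
  "jacobian c c' p = matrix (frechet_derivative (transition c c') (at (coord c p)))"

definition carrier :: "'m chart set \<Rightarrow> 'm set" where
  "carrier A = (\<Union>c\<in>A. chart_dom c)"

definition oriented_atlas :: "('m::topological_space) chart set \<Rightarrow> bool" where
  "oriented_atlas A \<longleftrightarrow>
     (\<forall>c\<in>A. is_chart c) \<and>
     (\<forall>c\<in>A. \<forall>c'\<in>A. smoothly_compatible c c' \<and>
        (\<forall>p\<in>chart_dom c \<inter> chart_dom c'. det (jacobian c c' p) > 0))"


section \<open>Tensor fields\<close>

text \<open>A tensor field on an open subset \<open>D\<close> of the manifold is given by its components at each
  point in each chart of the atlas, subject to smoothness and to the transformation law of its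
  type. For rank 2, \<open>T c p $ a $ b\<close> is the component with first index \<open>a\<close> and second index
  \<open>b\<close>; likewise in rank 3.\<close>

type_synonym ('m, 'v) tensor_field = "'m chart \<Rightarrow> 'm \<Rightarrow> 'v"

definition smooth_components ::
  "'m chart set \<Rightarrow> 'm set \<Rightarrow> ('m, 'v::real_normed_vector) tensor_field \<Rightarrow> bool" where
  "smooth_components A D T \<longleftrightarrow>
     (\<forall>c\<in>A. smooth_on (coord c ` (chart_dom c \<inter> D)) (T c \<circ> chart_inv c))"

definition vector_field :: "'m chart set \<Rightarrow> 'm set \<Rightarrow> ('m, real^4) tensor_field \<Rightarrow> bool" where
  "vector_field A D X \<longleftrightarrow> smooth_components A D X \<and>
     (\<forall>c\<in>A. \<forall>c'\<in>A. \<forall>p\<in>chart_dom c \<inter> chart_dom c' \<inter> D. X c' p = jacobian c c' p *v X c p)"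

definition covector_field :: "'m chart set \<Rightarrow> 'm set \<Rightarrow> ('m, real^4) tensor_field \<Rightarrow> bool" where
  "covector_field A D \<alpha> \<longleftrightarrow> smooth_components A D \<alpha> \<and>
     (\<forall>c\<in>A. \<forall>c'\<in>A. \<forall>p\<in>chart_dom c \<inter> chart_dom c' \<inter> D.
        \<alpha> c p = transpose (jacobian c c' p) *v \<alpha> c' p)"

definition covariant2_field ::
  "'m chart set \<Rightarrow> 'm set \<Rightarrow> ('m, real^4^4) tensor_field \<Rightarrow> bool" where
  "covariant2_field A D T \<longleftrightarrow> smooth_components A D T \<and>
     (\<forall>c\<in>A. \<forall>c'\<in>A. \<forall>p\<in>chart_dom c \<inter> chart_dom c' \<inter> D.
        T c p = transpose (jacobian c c' p) ** T c' p ** jacobian c c' p)"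

definition two_form :: "'m chart set \<Rightarrow> 'm set \<Rightarrow> ('m, real^4^4) tensor_field \<Rightarrow> bool" where
  "two_form A D F \<longleftrightarrow> covariant2_field A D F \<and>
     (\<forall>c\<in>A. \<forall>p\<in>chart_dom c \<inter> D. transpose (F c p) = - F c p)"


section \<open>Differential calculus\<close>

definition partial :: "'m chart \<Rightarrow> 4 \<Rightarrow> ('m \<Rightarrow> real) \<Rightarrow> 'm \<Rightarrow> real" where
  "partial c i f p = frechet_derivative (f \<circ> chart_inv c) (at (coord c p)) (axis i 1)"

text \<open>\<open>has_differential A D f \<alpha>\<close>: the function \<open>f\<close> is differentiable on the open set \<open>D\<close> and
  \<open>df = \<alpha>\<close> there.\<close>

definition has_differential ::
  "'m chart set \<Rightarrow> 'm set \<Rightarrow> ('m \<Rightarrow> real) \<Rightarrow> ('m, real^4) tensor_field \<Rightarrow> bool" where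
  "has_differential A D f \<alpha> \<longleftrightarrow>
     (\<forall>c\<in>A. \<forall>p\<in>chart_dom c \<inter> D.
        ((f \<circ> chart_inv c) has_derivative (\<lambda>v. \<alpha> c p \<bullet> v)) (at (coord c p)))"

definition ext_d1 :: "('m, real^4) tensor_field \<Rightarrow> ('m, real^4^4) tensor_field" where
  "ext_d1 \<alpha> c p = (\<chi> a b. partial c a (\<lambda>q. \<alpha> c q $ b) p - partial c b (\<lambda>q. \<alpha> c q $ a) p)"

definition ext_d2 :: "('m, real^4^4) tensor_field \<Rightarrow> ('m, real^4^4^4) tensor_field" where
  "ext_d2 F c p = (\<chi> a b d. partial c a (\<lambda>q. F c q $ b $ d) p
     + partial c b (\<lambda>q. F c q $ d $ a) p + partial c d (\<lambda>q. F c q $ a $ b) p)"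

definition lie_derivative2 ::
  "('m, real^4) tensor_field \<Rightarrow> ('m, real^4^4) tensor_field \<Rightarrow> ('m, real^4^4) tensor_field" where
  "lie_derivative2 X T c p = (\<chi> a b. \<Sum>i\<in>UNIV.
     X c p $ i * partial c i (\<lambda>q. T c q $ a $ b) p
     + T c p $ i $ b * partial c a (\<lambda>q. X c q $ i) p
     + T c p $ a $ i * partial c b (\<lambda>q. X c q $ i) p)"


section \<open>Pointwise exterior algebra\<close>

definition wedge21 :: "real^4^4 \<Rightarrow> real^4 \<Rightarrow> real^4^4^4" where
  "wedge21 F \<alpha> = (\<chi> a b d. F$a$b * \<alpha>$d + F$b$d * \<alpha>$a + F$d$a * \<alpha>$b)"

definition wedge12 :: "real^4 \<Rightarrow> real^4^4 \<Rightarrow> real^4^4^4" where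
  "wedge12 \<alpha> F = (\<chi> a b d. \<alpha>$a * F$b$d + \<alpha>$b * F$d$a + \<alpha>$d * F$a$b)"

definition contract2 :: "real^4 \<Rightarrow> real^4^4 \<Rightarrow> real^4" where
  "contract2 v F = (\<chi> b. \<Sum>a\<in>UNIV. v$a * F$a$b)"

text \<open>In the following, \<open>G\<close> is the matrix of metric components at a point in a positively
  oriented chart.\<close>

definition lower :: "real^4^4 \<Rightarrow> real^4 \<Rightarrow> real^4" where
  "lower G v = G *v v"

definition raise1 :: "real^4^4 \<Rightarrow> real^4 \<Rightarrow> real^4" where
  "raise1 G \<alpha> = (\<chi> a. \<Sum>i\<in>UNIV. matrix_inv G $ a $ i * \<alpha>$i)"

definition raise2 :: "real^4^4 \<Rightarrow> real^4^4 \<Rightarrow> real^4^4" where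
  "raise2 G F = (\<chi> a b. \<Sum>i\<in>UNIV. \<Sum>j\<in>UNIV.
     matrix_inv G $ a $ i * matrix_inv G $ b $ j * F$i$j)"

definition raise3 :: "real^4^4 \<Rightarrow> real^4^4^4 \<Rightarrow> real^4^4^4" where
  "raise3 G T = (\<chi> a b d. \<Sum>i\<in>UNIV. \<Sum>j\<in>UNIV. \<Sum>k\<in>UNIV.
     matrix_inv G $ a $ i * matrix_inv G $ b $ j * matrix_inv G $ d $ k * T$i$j$k)"

text \<open>The permutation symbol with \<open>levi_civita 0 1 2 3 = 1\<close>, as the determinant of the matrix
  whose rows are the unit vectors with the given indices.\<close>

definition levi_civita :: "4 \<Rightarrow> 4 \<Rightarrow> 4 \<Rightarrow> 4 \<Rightarrow> real" where
  "levi_civita a b d e = det (\<chi> i.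
     axis (if i = 0 then a else if i = 1 then b else if i = 2 then d else e) 1 :: real^4^4)"

definition volume_form :: "real^4^4 \<Rightarrow> 4 \<Rightarrow> 4 \<Rightarrow> 4 \<Rightarrow> 4 \<Rightarrow> real" where
  "volume_form G a b d e = sqrt \<bar>det G\<bar> * levi_civita a b d e"

definition hodge1 :: "real^4^4 \<Rightarrow> real^4 \<Rightarrow> real^4^4^4" where
  "hodge1 G \<alpha> = (\<chi> b d e. \<Sum>a\<in>UNIV. raise1 G \<alpha> $ a * volume_form G a b d e)"

definition hodge2 :: "real^4^4 \<Rightarrow> real^4^4 \<Rightarrow> real^4^4" where
  "hodge2 G F = (\<chi> d e. (1/2) * (\<Sum>a\<in>UNIV. \<Sum>b\<in>UNIV. raise2 G F $ a $ b * volume_form G a b d e))"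

definition hodge3 :: "real^4^4 \<Rightarrow> real^4^4^4 \<Rightarrow> real^4" where
  "hodge3 G T = (\<chi> e. (1/6) * (\<Sum>a\<in>UNIV. \<Sum>b\<in>UNIV. \<Sum>d\<in>UNIV.
     raise3 G T $ a $ b $ d * volume_form G a b d e))"

definition flat_field ::
  "('m, real^4^4) tensor_field \<Rightarrow> ('m, real^4) tensor_field \<Rightarrow> ('m, real^4) tensor_field" where
  "flat_field g X c p = lower (g c p) (X c p)"

definition hodge2_field ::
  "('m, real^4^4) tensor_field \<Rightarrow> ('m, real^4^4) tensor_field \<Rightarrow> ('m, real^4^4) tensor_field" where
  "hodge2_field g F c p = hodge2 (g c p) (F c p)"


section \<open>Static spacetimes\<close>

definition minkowski :: "real^4^4" where
  "minkowski = (\<chi> a b. if a = b then (if a = 0 then -1 else 1) else 0)"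

definition lorentzian :: "real^4^4 \<Rightarrow> bool" where
  "lorentzian G \<longleftrightarrow> transpose G = G \<and>
     (\<exists>E. invertible E \<and> transpose E ** G ** E = minkowski)"

definition lorentzian_metric ::
  "'m chart set \<Rightarrow> ('m, real^4^4) tensor_field \<Rightarrow> bool" where
  "lorentzian_metric A g \<longleftrightarrow> covariant2_field A (carrier A) g \<and>
     (\<forall>c\<in>A. \<forall>p\<in>chart_dom c. lorentzian (g c p))"

definition spacetime ::
  "('m::{t2_space, second_countable_topology}) chart set \<Rightarrow> ('m, real^4^4) tensor_field \<Rightarrow> bool" where
  "spacetime A g \<longleftrightarrow> oriented_atlas A \<and> carrier A \<noteq> {} \<and> connected (carrier A) \<and>
     lorentzian_metric A g"

definition metric_ip :: "real^4^4 \<Rightarrow> real^4 \<Rightarrow> real^4 \<Rightarrow> real" where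
  "metric_ip G u v = u \<bullet> (G *v v)"

definition killing_field ::
  "'m chart set \<Rightarrow> ('m, real^4^4) tensor_field \<Rightarrow> ('m, real^4) tensor_field \<Rightarrow> bool" where
  "killing_field A g k \<longleftrightarrow> vector_field A (carrier A) k \<and>
     (\<forall>c\<in>A. \<forall>p\<in>chart_dom c. lie_derivative2 k g c p = 0)"

definition stationary_field ::
  "('m::topological_space) chart set \<Rightarrow> ('m, real^4^4) tensor_field \<Rightarrow> ('m, real^4) tensor_field \<Rightarrow> bool" where
  "stationary_field A g k \<longleftrightarrow> killing_field A g k \<and>
     (\<exists>R. open R \<and> R \<noteq> {} \<and> R \<subseteq> carrier A \<and>
        (\<forall>c\<in>A. \<forall>p\<in>chart_dom c \<inter> R. metric_ip (g c p) (k c p) (k c p) < 0))"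

definition twist ::
  "('m, real^4^4) tensor_field \<Rightarrow> ('m, real^4) tensor_field \<Rightarrow> ('m, real^4) tensor_field" where
  "twist g k c p = - hodge3 (g c p) (wedge12 (flat_field g k c p) (ext_d1 (flat_field g k) c p))"

definition static_spacetime ::
  "('m::{t2_space, second_countable_topology}) chart set \<Rightarrow> ('m, real^4^4) tensor_field \<Rightarrow>
     ('m, real^4) tensor_field \<Rightarrow> bool" where
  "static_spacetime A g k \<longleftrightarrow> spacetime A g \<and> stationary_field A g k \<and>
     (\<forall>c\<in>A. \<forall>p\<in>chart_dom c. twist g k c p = 0)"


section \<open>Killing horizons\<close>

text \<open>Embedded hypersurfaces, by slice charts \<open>s\<close> of the smooth structure generated by \<open>A\<close>.
  The chart \<open>s\<close> need not belong to \<open>A\<close>.\<close>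

definition hypersurface :: "('m::topological_space) chart set \<Rightarrow> 'm set \<Rightarrow> bool" where
  "hypersurface A H \<longleftrightarrow> H \<subseteq> carrier A \<and>
     (\<forall>p\<in>H. \<exists>s. is_chart s \<and> p \<in> chart_dom s \<and> chart_dom s \<subseteq> carrier A \<and>
        (\<forall>c\<in>A. smoothly_compatible c s) \<and>
        coord s ` (H \<inter> chart_dom s) = {x \<in> coord s ` chart_dom s. x $ 0 = 0})"

text \<open>The tangent space of \<open>H\<close> at \<open>p\<close>, in components with respect to the chart \<open>c\<close>: the
  velocities at \<open>p\<close> of smooth curves in \<open>H\<close>.\<close>

definition tangent_space :: "'m set \<Rightarrow> 'm chart \<Rightarrow> 'm \<Rightarrow> (real^4) set" where
  "tangent_space H c p = {v. \<exists>(\<gamma> :: real \<Rightarrow> 'm) e. e > 0 \<and> \<gamma> ` {-e<..<e} \<subseteq> H \<inter> chart_dom c \<and>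
     smooth_on {-e<..<e} (coord c \<circ> \<gamma>) \<and> \<gamma> 0 = p \<and>
     ((coord c \<circ> \<gamma>) has_vector_derivative v) (at 0)}"

definition normal_at ::
  "('m, real^4^4) tensor_field \<Rightarrow> 'm set \<Rightarrow> 'm chart \<Rightarrow> 'm \<Rightarrow> real^4 \<Rightarrow> bool" where
  "normal_at g H c p n \<longleftrightarrow> (\<forall>v\<in>tangent_space H c p. metric_ip (g c p) n v = 0)"

definition null_hypersurface ::
  "('m::topological_space) chart set \<Rightarrow> ('m, real^4^4) tensor_field \<Rightarrow> 'm set \<Rightarrow> bool" where
  "null_hypersurface A g H \<longleftrightarrow> hypersurface A H \<and>
     (\<forall>c\<in>A. \<forall>p\<in>chart_dom c \<inter> H. \<exists>n. n \<noteq> 0 \<and> normal_at g H c p n \<and> metric_ip (g c p) n n = 0)"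

definition killing_horizon ::
  "('m::topological_space) chart set \<Rightarrow> ('m, real^4^4) tensor_field \<Rightarrow> ('m, real^4) tensor_field \<Rightarrow>
     'm set \<Rightarrow> bool" where
  "killing_horizon A g k H \<longleftrightarrow> null_hypersurface A g H \<and>
     (\<forall>c\<in>A. \<forall>p\<in>chart_dom c \<inter> H. normal_at g H c p (k c p))"


section \<open>Electromagnetic fields\<close>

text \<open>The field and its sources are smooth tensor fields on an open set \<open>D\<close>, which need not be
  the whole spacetime.\<close>

definition maxwell_solution ::
  "'m chart set \<Rightarrow> ('m, real^4^4) tensor_field \<Rightarrow> 'm set \<Rightarrow> ('m, real^4^4) tensor_field \<Rightarrow>
     ('m, real^4) tensor_field \<Rightarrow> ('m, real^4) tensor_field \<Rightarrow> bool" where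
  "maxwell_solution A g D F Je Jm \<longleftrightarrow>
     two_form A D F \<and> covector_field A D Je \<and> covector_field A D Jm \<and>
     (\<forall>c\<in>A. \<forall>p\<in>chart_dom c \<inter> D.
        ext_d2 F c p = (4 * pi) *\<^sub>R hodge1 (g c p) (Jm c p) \<and>
        ext_d2 (hodge2_field g F) c p = (4 * pi) *\<^sub>R hodge1 (g c p) (Je c p))"

definition invariant_under ::
  "'m chart set \<Rightarrow> 'm set \<Rightarrow> ('m, real^4) tensor_field \<Rightarrow> ('m, real^4^4) tensor_field \<Rightarrow> bool" where
  "invariant_under A D k F \<longleftrightarrow> (\<forall>c\<in>A. \<forall>p\<in>chart_dom c \<inter> D. lie_derivative2 k F c p = 0)"

text \<open>\<open>F \<and> k = 0\<close> on \<open>D\<close>.\<close>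

definition wedge_vanishes ::
  "'m chart set \<Rightarrow> ('m, real^4^4) tensor_field \<Rightarrow> 'm set \<Rightarrow> ('m, real^4^4) tensor_field \<Rightarrow>
     ('m, real^4) tensor_field \<Rightarrow> bool" where
  "wedge_vanishes A g D F k \<longleftrightarrow>
     (\<forall>c\<in>A. \<forall>p\<in>chart_dom c \<inter> D. wedge21 (F c p) (flat_field g k c p) = 0)"

definition electric_potential ::
  "'m chart set \<Rightarrow> 'm set \<Rightarrow> ('m, real^4) tensor_field \<Rightarrow> ('m, real^4^4) tensor_field \<Rightarrow>
     ('m \<Rightarrow> real) \<Rightarrow> bool" where
  "electric_potential A U k F \<Phi> \<longleftrightarrow>
     has_differential A U \<Phi> (\<lambda>c p. - contract2 (k c p) (F c p))"

definition magnetic_potential ::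
  "'m chart set \<Rightarrow> ('m, real^4^4) tensor_field \<Rightarrow> 'm set \<Rightarrow> ('m, real^4) tensor_field \<Rightarrow>
     ('m, real^4^4) tensor_field \<Rightarrow> ('m \<Rightarrow> real) \<Rightarrow> bool" where
  "magnetic_potential A g U k F \<Psi> \<longleftrightarrow>
     has_differential A U \<Psi> (\<lambda>c p. contract2 (k c p) (hodge2_field g F c p))"

end

theory Submission
  imports Defs
begin

text \<open>Pointwise, \<open>F \<and> k = 0\<close> forces \<open>i\<^sub>k *F = 0\<close>, and contracting \<open>F \<and> k = 0\<close> with \<open>k\<close> where \<open>k\<close> is
  null shows that \<open>i\<^sub>k F\<close> is proportional to the 1-form \<open>k\<close>, which annihilates all vectors tangent
  to the horizon; likewise \<open>*F \<and> k = 0\<close> forces \<open>i\<^sub>k F = 0\<close>. The field \<open>k\<close> is null on the whole horizon,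
  its zeros included, since it is proportional to the null normal. So in either case both potentials have
  vanishing tangential derivative along the horizon.\<close>

section \<open>Pointwise algebra of the Hodge dual\<close>

lemma UNIV_4_alt: "(UNIV :: 4 set) = {0, 1, 2, 3}"
proof -
  \<comment> \<open>Numerals of type \<open>4\<close> are taken modulo 4, so the last element listed
    by \<open>UNIV_4\<close> is the index 0.\<close>
  have "(4::4) = 0" by simp
  then show ?thesis
    unfolding UNIV_4 by (simp only: insert_commute)
qed

lemma sum_UNIV_4: "(\<Sum>i\<in>UNIV. f (i::4)) = f 0 + f 1 + f 2 + (f 3 :: 'a::comm_monoid_add)"
  unfolding UNIV_4_alt by (simp add: add.assoc)

lemma forall_4_alt: "(\<forall>i::4. P i) \<longleftrightarrow> P 0 \<and> P 1 \<and> P 2 \<and> P 3"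
  by (metis UNIV_4_alt UNIV_I empty_iff insert_iff)

lemma levi_civita_repeated:
  "levi_civita a a d e = 0" "levi_civita a b b e = 0" "levi_civita a b d d = 0"
  unfolding levi_civita_def
    apply (rule det_identical_rows[of 0 1]; simp add: row_def)
   apply (rule det_identical_rows[of 1 2]; simp add: row_def)
  apply (rule det_identical_rows[of 2 3]; simp add: row_def)
  done

lemma det_swap_rows:
  fixes M :: "'a::comm_ring_1^'n^'n"
  assumes "i \<noteq> j"
  shows "det (\<chi> r. M $ Transposition.transpose i j r) = - det M"
  using det_permute_rows[of "Transposition.transpose i j" M] assms
  by (simp add: permutes_swap_id sign_swap_id)

lemma levi_civita_swap:
  "levi_civita y x d e = - levi_civita x y d e"
  "levi_civita a y x e = - levi_civita a x y e"
  "levi_civita a b y x = - levi_civita a b x y"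
  unfolding levi_civita_def
    apply (subst det_swap_rows[of 0 1, symmetric], simp,
      rule arg_cong[of _ _ det], simp add: vec_eq_iff forall_4_alt transpose_def)
   apply (subst det_swap_rows[of 1 2, symmetric], simp,
      rule arg_cong[of _ _ det], simp add: vec_eq_iff forall_4_alt transpose_def)
  apply (subst det_swap_rows[of 2 3, symmetric], simp,
      rule arg_cong[of _ _ det], simp add: vec_eq_iff forall_4_alt transpose_def)
  done

lemma levi_civita_0123: "levi_civita 0 1 2 3 = 1"
proof -
  have "(\<chi> i. axis (if i = 0 then 0 else if i = 1 then 1 else if i = 2 then 2 else 3) 1 :: real^4^4)
     = mat 1"
    by (simp add: vec_eq_iff forall_4_alt mat_def axis_def)
  then show ?thesis unfolding levi_civita_def by simp
qed

text \<open>Oriented rewrite rules that bubble-sort the indices.\<close>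

lemmas levi_civita_sort =
  levi_civita_swap[where y = 1 and x = 0] levi_civita_swap[where y = 2 and x = 0] levi_civita_swap[where y = 3 and x = 0]
  levi_civita_swap[where y = 2 and x = 1] levi_civita_swap[where y = 3 and x = 1] levi_civita_swap[where y = 3 and x = 2]

section \<open>Skew matrices and the components of the dual of a 2-form\<close>

lemma skew_nth:
  fixes P :: "real^'n^'n"
  assumes "transpose P = - P"
  shows "P$i$j = - P$j$i"
  using arg_cong[OF assms, of "\<lambda>M. M$j$i"] by (simp add: transpose_def)

lemma skew_4:
  fixes P :: "real^4^4"
  assumes "transpose P = - P"
  shows "P$0$0 = 0" "P$1$1 = 0" "P$2$2 = 0" "P$3$3 = 0"
    "P$1$0 = - P$0$1" "P$2$0 = - P$0$2" "P$3$0 = - P$0$3"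
    "P$2$1 = - P$1$2" "P$3$1 = - P$1$3" "P$3$2 = - P$2$3"
proof -
  note * = skew_nth[OF assms]
  from *[of 0 0] *[of 1 1] *[of 2 2] *[of 3 3]
    *[of 1 0] *[of 2 0] *[of 3 0] *[of 2 1] *[of 3 1] *[of 3 2]
  show "P$0$0 = 0" "P$1$1 = 0" "P$2$2 = 0" "P$3$3 = 0"
    "P$1$0 = - P$0$1" "P$2$0 = - P$0$2" "P$3$0 = - P$0$3"
    "P$2$1 = - P$1$2" "P$3$1 = - P$1$3" "P$3$2 = - P$2$3"
    by linarith+
qed

lemma raise2_eq: "raise2 G F = matrix_inv G ** F ** transpose (matrix_inv G)"
  unfolding raise2_def
  by (simp add: vec_eq_iff matrix_matrix_mult_def transpose_def sum_UNIV_4 algebra_simps)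

lemma matrix_mul_uminus: "A ** (- B) = - (A ** B)" "(- A) ** B = - (A ** B)"
  for A :: "real^'n^'m" and B
  by (simp_all add: matrix_matrix_mult_def vec_eq_iff sum_negf)

lemma skew_raise2: "transpose F = - F \<Longrightarrow> transpose (raise2 G F) = - raise2 G F"
  by (simp add: raise2_eq matrix_transpose_mul matrix_mul_uminus matrix_mul_assoc)

text \<open>Only the two orderings of the complementary index pair survive in the sum. They
  contribute equally because the raised form is skew, which cancels the factor 1/2; the sign is that
  of the permutation formed by the complementary pair followed by the given pair.\<close>

lemma hodge2_components:
  fixes G F :: "real^4^4"
  assumes "transpose F = - F"
  defines "P \<equiv> raise2 G F" and "s \<equiv> sqrt \<bar>det G\<bar>"
  shows "hodge2 G F $ 0 $ 1 = s * P$2$3" "hodge2 G F $ 0 $ 2 = - s * P$1$3"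
    "hodge2 G F $ 0 $ 3 = s * P$1$2" "hodge2 G F $ 1 $ 2 = s * P$0$3"
    "hodge2 G F $ 1 $ 3 = - s * P$0$2" "hodge2 G F $ 2 $ 3 = s * P$0$1"
proof -
  note skew = skew_4[OF skew_raise2[OF assms(1), of G], folded P_def]
  show "hodge2 G F $ 0 $ 1 = s * P$2$3" "hodge2 G F $ 0 $ 2 = - s * P$1$3"
    "hodge2 G F $ 0 $ 3 = s * P$1$2" "hodge2 G F $ 1 $ 2 = s * P$0$3"
    "hodge2 G F $ 1 $ 3 = - s * P$0$2" "hodge2 G F $ 2 $ 3 = s * P$0$1"
    unfolding hodge2_def vec_lambda_beta volume_form_def P_def[symmetric] s_def[symmetric]
      sum_UNIV_4
    by (simp_all only: levi_civita_sort levi_civita_repeated levi_civita_0123 skew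
        mult_zero_left mult_zero_right add_0_left add_0_right minus_zero mult_minus_left
        mult_minus_right minus_minus mult_1_right) simp_all
qed

lemma skew_hodge2: "transpose (hodge2 G F) = - hodge2 G F"
proof -
  have vol: "volume_form G a b e d = - volume_form G a b d e" for a b d e
    unfolding volume_form_def by (subst levi_civita_swap(3)) simp
  have "hodge2 G F $ e $ d = - hodge2 G F $ d $ e" for d e
    unfolding hodge2_def vec_lambda_beta vol[of _ _ e d]
    by (simp only: mult_minus_right sum_negf)
  then show ?thesis
    unfolding vec_eq_iff transpose_def vec_lambda_beta vector_uminus_component by blast
qed

section \<open>Contractions with \<open>k\<close> under the staticity conditions\<close>

lemma contract2_eq: "contract2 v F = transpose F *v v"
  by (simp add: contract2_def matrix_vector_mult_def transpose_def vec_eq_iff mult.commute)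

lemma matrix_inv_cancel:
  assumes "invertible G"
  shows "G ** matrix_inv G = mat 1" "matrix_inv G ** G = mat 1"
  using assms someI_ex[of "\<lambda>G'. G ** G' = mat 1 \<and> G' ** G = mat 1"]
  unfolding invertible_def matrix_inv_def by blast+

lemma matrix_inv_mult:
  fixes G :: "real^'n^'n"
  assumes "invertible G"
  shows "matrix_inv G *v (G *v v) = v"
  using assms by (simp add: matrix_vector_mul_assoc matrix_inv_cancel)

text \<open>Raising all three indices is linear, so it preserves the vanishing of the
  3-form.\<close>

lemma wedge21_raise:
  fixes G F :: "real^4^4" and \<kappa> :: "real^4"
  assumes "wedge21 F \<kappa> = 0"
  defines "P \<equiv> raise2 G F" and "k \<equiv> matrix_inv G *v \<kappa>"
  shows "P$a$b * k$d + P$b$d * k$a + P$d$a * k$b = 0"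
proof -
  let ?N = "matrix_inv G"
  have w: "F$i$j * \<kappa>$l + F$j$l * \<kappa>$i + F$l$i * \<kappa>$j = 0" for i j l
    using assms(1) by (simp add: wedge21_def vec_eq_iff)
  have P: "P$a$b = (\<Sum>i\<in>UNIV. \<Sum>j\<in>UNIV. ?N$a$i * ?N$b$j * F$i$j)" for a b
    by (simp add: P_def raise2_def)
  have k: "k$d = (\<Sum>l\<in>UNIV. ?N$d$l * \<kappa>$l)" for d
    by (simp add: k_def matrix_vector_mult_def)
  \<comment> \<open>The other two terms are instances of this expansion under cyclic shifts of the
    free indices; reordering their sums gives all three terms the same coefficients.\<close>
  have 1: "P$a$b * k$d = (\<Sum>i\<in>UNIV. \<Sum>j\<in>UNIV. \<Sum>l\<in>UNIV. ?N$a$i * ?N$b$j * ?N$d$l * (F$i$j * \<kappa>$l))"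
    for a b d
    unfolding P k by (simp add: sum_distrib_left sum_distrib_right mult_ac)
  have 2: "P$b$d * k$a = (\<Sum>i\<in>UNIV. \<Sum>j\<in>UNIV. \<Sum>l\<in>UNIV. ?N$a$i * ?N$b$j * ?N$d$l * (F$j$l * \<kappa>$i))"
    unfolding 1
    by (subst (2) sum.swap, subst sum.swap) (simp add: mult_ac)
  have 3: "P$d$a * k$b = (\<Sum>i\<in>UNIV. \<Sum>j\<in>UNIV. \<Sum>l\<in>UNIV. ?N$a$i * ?N$b$j * ?N$d$l * (F$l$i * \<kappa>$j))"
    unfolding 1
    by (subst sum.swap, subst (2) sum.swap) (simp add: mult_ac)
  have "P$a$b * k$d + P$b$d * k$a + P$d$a * k$b =
    (\<Sum>i\<in>UNIV. \<Sum>j\<in>UNIV. \<Sum>l\<in>UNIV.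
      ?N$a$i * ?N$b$j * ?N$d$l * (F$i$j * \<kappa>$l + F$j$l * \<kappa>$i + F$l$i * \<kappa>$j))"
    unfolding 1[of a b d] 2 3 by (simp add: sum.distrib distrib_left)
  then show ?thesis by (simp add: w)
qed

text \<open>This is the identity i_k *F = *(F \<and> k), read off in components.\<close>

lemma contract2_hodge2_zero:
  assumes "invertible G" "transpose F = - F" "wedge21 F (lower G k) = 0"
  shows "contract2 k (hodge2 G F) = 0"
proof -
  define P where "P = raise2 G F"
  have w: "P$a$b * k$d + P$b$d * k$a + P$d$a * k$b = 0" for a b d
    using wedge21_raise[OF assms(3), of G a b d] assms(1)
    by (simp add: P_def lower_def matrix_inv_mult)
  note comps = hodge2_components[OF assms(2), of G, folded P_def]
  show ?thesis
    unfolding vec_eq_iff forall_4_alt zero_index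
  \<comment> \<open>Each component of the contraction is, up to sign,
    \<open>sqrt \<bar>det G\<bar>\<close> times the component of the raised 3-form on the other
    three indices.\<close>
  proof (intro conjI)
    show "contract2 k (hodge2 G F) $ 0 = 0"
      using w[of 1 2 3, THEN arg_cong, of "(*) (sqrt \<bar>det G\<bar>)"]
      by (simp add: contract2_def sum_UNIV_4 skew_4[OF skew_hodge2] comps
          skew_4[OF skew_raise2[OF assms(2)], of G, folded P_def] algebra_simps)
    show "contract2 k (hodge2 G F) $ 1 = 0"
      using w[of 0 2 3, THEN arg_cong, of "(*) (sqrt \<bar>det G\<bar>)"]
      by (simp add: contract2_def sum_UNIV_4 skew_4[OF skew_hodge2] comps
          skew_4[OF skew_raise2[OF assms(2)], of G, folded P_def] algebra_simps)
    show "contract2 k (hodge2 G F) $ 2 = 0"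
      using w[of 0 1 3, THEN arg_cong, of "(*) (sqrt \<bar>det G\<bar>)"]
      by (simp add: contract2_def sum_UNIV_4 skew_4[OF skew_hodge2] comps
          skew_4[OF skew_raise2[OF assms(2)], of G, folded P_def] algebra_simps)
    show "contract2 k (hodge2 G F) $ 3 = 0"
      using w[of 0 1 2, THEN arg_cong, of "(*) (sqrt \<bar>det G\<bar>)"]
      by (simp add: contract2_def sum_UNIV_4 skew_4[OF skew_hodge2] comps
          skew_4[OF skew_raise2[OF assms(2)], of G, folded P_def] algebra_simps)
  qed
qed

text \<open>Applying the previous lemma to *F would require ** = -1 on 2-forms. Instead the
  components of *F \<and> k are identified directly with those of the raised field applied to the
  lowered \<open>k\<close>, and the index is lowered again.\<close>

lemma contract2_zero_of_hodge2:
  assumes "invertible G" "transpose G = G" "transpose F = - F"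
    and "wedge21 (hodge2 G F) (lower G k) = 0"
  shows "contract2 k F = 0"
proof -
  define P where "P = raise2 G F"
  define \<kappa> where "\<kappa> = G *v k"
  define s where "s = sqrt \<bar>det G\<bar>"
  let ?S = "hodge2 G F"
  have "s \<noteq> 0"
    using assms(1) by (simp add: s_def invertible_det_nz)
  have w: "?S$a$b * \<kappa>$d + ?S$b$d * \<kappa>$a + ?S$d$a * \<kappa>$b = 0" for a b d
    using assms(4) by (simp add: wedge21_def vec_eq_iff lower_def \<kappa>_def)
  note simps = hodge2_components[OF assms(3), of G, folded P_def s_def]
    skew_4[OF skew_hodge2[of G F]] skew_4[OF skew_raise2[OF assms(3)], of G, folded P_def]
  \<comment> \<open>Up to sign, this is the component of *F \<and> k on the three indices other than
    \<open>i\<close>.\<close>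
  have "s * ((P *v \<kappa>) $ i) = 0" for i
  proof -
    have "\<forall>i. s * ((P *v \<kappa>) $ i) = 0"
      unfolding forall_4_alt
    proof (intro conjI)
      show "s * ((P *v \<kappa>) $ 0) = 0"
        using w[of 1 2 3] by (simp add: matrix_vector_mult_def sum_UNIV_4 simps algebra_simps)
      show "s * ((P *v \<kappa>) $ 1) = 0"
        using w[of 0 2 3] by (simp add: matrix_vector_mult_def sum_UNIV_4 simps algebra_simps)
      show "s * ((P *v \<kappa>) $ 2) = 0"
        using w[of 0 1 3] by (simp add: matrix_vector_mult_def sum_UNIV_4 simps algebra_simps)
      show "s * ((P *v \<kappa>) $ 3) = 0"
        using w[of 0 1 2] by (simp add: matrix_vector_mult_def sum_UNIV_4 simps algebra_simps)
    qed
    then show ?thesis by blast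
  qed
  then have P\<kappa>: "P *v \<kappa> = 0"
    using \<open>s \<noteq> 0\<close> by (simp add: vec_eq_iff)
  have G: "G ** matrix_inv G = mat 1" "matrix_inv G ** G = mat 1"
    using assms(1) by (simp_all add: matrix_inv_cancel)
  have "transpose (matrix_inv G) ** G = mat 1"
    by (metis G(1) assms(2) matrix_transpose_mul transpose_mat)
  \<comment> \<open>\<open>P\<close> is F between \<open>matrix_inv G\<close> and its transpose; the
    outer factors \<open>G\<close> cancel both, the right one by symmetry of
    \<open>G\<close>.\<close>
  then have "G *v (P *v \<kappa>) = F *v k"
    unfolding P_def raise2_eq \<kappa>_def
    by (simp only: matrix_vector_mul_assoc flip: matrix_mul_assoc)
       (simp add: matrix_mul_assoc G)
  then have "F *v k = 0"
    using P\<kappa> by simp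
  then show ?thesis
    using assms(3) by (simp add: contract2_eq matrix_vector_mult_def vec_eq_iff sum_negf)
qed

text \<open>Where \<open>k\<close> is nonzero, i_k F is a multiple of the lowered \<open>k\<close>,
  which kills every vector orthogonal to \<open>k\<close>; at a zero of \<open>k\<close> the
  contraction vanishes anyway.\<close>

lemma contract2_orthogonal:
  assumes "invertible G" "transpose G = G" "transpose F = - F"
    and "wedge21 F (lower G k) = 0" "metric_ip G k k = 0" "metric_ip G k v = 0"
  shows "contract2 k F \<bullet> v = 0"
proof (cases "k = 0")
  case True
  then show ?thesis by (simp add: contract2_eq)
next
  case False
  define \<kappa> where "\<kappa> = G *v k"
  define \<beta> where "\<beta> = contract2 k F"
  have "\<kappa> \<noteq> 0"
    using matrix_inv_mult[OF assms(1), of k] False by (auto simp: \<kappa>_def)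
  then obtain d where d: "\<kappa>$d \<noteq> 0"
    by (auto simp: vec_eq_iff)
  have \<kappa>u: "(\<Sum>a\<in>UNIV. \<kappa>$a * u$a) = metric_ip G k u" for u
    using dot_lmul_matrix[of k G u] assms(2)
    by (metis \<kappa>_def inner_real_def inner_vec_def metric_ip_def transpose_matrix_vector)
  have w: "F$a$b * \<kappa>$d + F$b$d * \<kappa>$a + F$d$a * \<kappa>$b = 0" for a b d
    using assms(4) by (simp add: wedge21_def vec_eq_iff lower_def \<kappa>_def)
  note skew = skew_nth[OF assms(3)]
  \<comment> \<open>Contraction of F \<and> k with \<open>k\<close> in the slot \<open>a\<close>.
    Nullness removes the middle term, and what remains says that \<open>\<beta>\<close> and
    \<open>\<kappa>\<close> are parallel.\<close>
  have "\<beta>$b * \<kappa>$d + F$b$d * metric_ip G k k - \<beta>$d * \<kappa>$b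
      = (\<Sum>a\<in>UNIV. k$a * (F$a$b * \<kappa>$d + F$b$d * \<kappa>$a + F$d$a * \<kappa>$b))" for b d
    unfolding \<kappa>u[symmetric] \<beta>_def contract2_def skew[of d _]
    by (simp add: sum_distrib_left sum_distrib_right sum_subtractf sum.distrib algebra_simps)
  then have p: "\<beta>$b * \<kappa>$d = \<beta>$d * \<kappa>$b" for b d
    by (simp add: w assms(5))
  have "(\<beta> \<bullet> v) * \<kappa>$d = (\<Sum>b\<in>UNIV. (\<beta>$b * \<kappa>$d) * v$b)"
    by (simp add: inner_vec_def sum_distrib_left sum_distrib_right mult_ac)
  also have "\<dots> = (\<Sum>b\<in>UNIV. (\<beta>$d * \<kappa>$b) * v$b)"
    by (rule sum.cong, rule refl, metis p)
  also have "\<dots> = \<beta>$d * metric_ip G k v"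
    unfolding \<kappa>u[symmetric] by (simp add: sum_distrib_left mult_ac)
  finally show ?thesis
    using d assms(6) by (simp add: \<beta>_def)
qed

lemma lorentzian_invertible: "lorentzian G \<Longrightarrow> invertible G"
proof -
  assume "lorentzian G"
  then obtain E where "transpose E ** G ** E = minkowski"
    by (auto simp: lorentzian_def)
  then have "det (transpose E) * det G * det E = det minkowski"
    by (metis det_mul)
  moreover have "det minkowski \<noteq> 0"
    by (subst det_diagonal) (auto simp: minkowski_def)
  ultimately show ?thesis by (auto simp: invertible_det_nz)
qed

section \<open>Tangent spaces of hypersurfaces\<close>

text \<open>A derivative at a point of an open set sees only nearby values, so equality on
  \<open>S\<close> passes to all directional derivatives and the induction applies to those.\<close>

lemma higher_differentiable_on_cong:
  assumes "open S" "\<And>x. x \<in> S \<Longrightarrow> f x = g x" "higher_differentiable_on S f n"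
  shows "higher_differentiable_on S g n"
  using assms(2,3)
proof (induction n arbitrary: f g)
  case 0
  then show ?case using continuous_on_cong by fastforce
next
  case (Suc n)
  have f: "(f has_derivative frechet_derivative f (at x)) (at x)" if "x \<in> S" for x
    using Suc.prems(2) that by (simp add: frechet_derivative_works)
  have g: "(g has_derivative frechet_derivative f (at x)) (at x)" if "x \<in> S" for x
    using has_derivative_transform_within_open[OF f[OF that] assms(1) that] Suc.prems(1) by blast
  have eq: "frechet_derivative f (at x) v = frechet_derivative g (at x) v" if "x \<in> S" for x v
    using frechet_derivative_at[OF g[OF that]] by simp
  show ?case
    using g Suc.IH[OF eq] Suc.prems(2) by (auto simp: differentiable_def)
qed

text \<open>By the chain rule the derivative along the line is a directional derivative of
  \<open>f\<close> in a constant direction, evaluated on the same line. It has the original shape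
  again, so the induction closes. This supplies the smoothness of the curves that witness tangent
  vectors.\<close>

lemma higher_differentiable_on_affine:
  fixes f :: "'a::real_normed_vector \<Rightarrow> 'b::real_normed_vector"
  assumes "open T" "\<And>t. t \<in> T \<Longrightarrow> x + t *\<^sub>R w \<in> S" "higher_differentiable_on S f n"
  shows "higher_differentiable_on T (\<lambda>t::real. f (x + t *\<^sub>R w)) n"
  using assms(3)
proof (induction n arbitrary: f)
  case 0
  then have "continuous_on T (f \<circ> (\<lambda>t. x + t *\<^sub>R w))"
    using assms(2) by (intro continuous_on_compose continuous_intros)
      (auto elim: continuous_on_subset)
  then show ?case by (simp add: o_def)
next
  case (Suc n)
  let ?f' = "\<lambda>y. frechet_derivative f (at y)"
  have f: "((\<lambda>t. f (x + t *\<^sub>R w)) has_derivative (\<lambda>u. ?f' (x + t *\<^sub>R w) (u *\<^sub>R w))) (at t)"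
    if "t \<in> T" for t
  proof -
    have "(f has_derivative ?f' (x + t *\<^sub>R w)) (at (x + t *\<^sub>R w))"
      using Suc.prems assms(2)[OF that] by (simp add: frechet_derivative_works)
    moreover have "((\<lambda>t. x + t *\<^sub>R w) has_derivative (\<lambda>u. u *\<^sub>R w)) (at t)"
      by (auto intro!: derivative_eq_intros)
    ultimately show ?thesis
      using diff_chain_at[of "\<lambda>t. x + t *\<^sub>R w"] by (fastforce simp: o_def)
  qed
  have "higher_differentiable_on T (\<lambda>t. frechet_derivative (\<lambda>t. f (x + t *\<^sub>R w)) (at t) u) n" for u
  proof (rule higher_differentiable_on_cong[OF assms(1)])
    show "higher_differentiable_on T (\<lambda>t. ?f' (x + t *\<^sub>R w) (u *\<^sub>R w)) n"
      using Suc.IH[of "\<lambda>y. ?f' y (u *\<^sub>R w)"] Suc.prems by simp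
    show "?f' (x + t *\<^sub>R w) (u *\<^sub>R w) = frechet_derivative (\<lambda>t. f (x + t *\<^sub>R w)) (at t) u"
      if "t \<in> T" for t
      using frechet_derivative_at[OF f[OF that]] by metis
  qed
  then show ?case
    using f by (auto simp: differentiable_def)
qed

lemma smooth_on_has_derivative:
  assumes "smooth_on S f" "x \<in> S"
  shows "(f has_derivative frechet_derivative f (at x)) (at x)"
  using assms(1)[unfolded smooth_on_def, rule_format, of "Suc 0"] assms(2)
  by (simp add: frechet_derivative_works)

section \<open>Charts and derivatives of transition maps\<close>

lemma chart_inv_coord: "is_chart s \<Longrightarrow> p \<in> chart_dom s \<Longrightarrow> chart_inv s (coord s p) = p"
  by (simp add: is_chart_def homeomorphism_def)

lemma open_coord_image:
  assumes "is_chart s" "open V"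
  shows "open (coord s ` (V \<inter> chart_dom s))"
proof -
  have "openin (top_of_set (chart_dom s)) (V \<inter> chart_dom s)"
    using assms(2) by (auto simp: openin_open)
  then have "openin (top_of_set (coord s ` chart_dom s)) (coord s ` (V \<inter> chart_dom s))"
    using assms(1) homeomorphism_imp_open_map by (auto simp: is_chart_def)
  then show ?thesis
    using assms(1) openin_open_eq by (auto simp: is_chart_def)
qed

lemma transition_coord:
  "is_chart s \<Longrightarrow> p \<in> chart_dom s \<Longrightarrow> transition s c (coord s p) = coord c p"
  by (simp add: transition_def chart_inv_coord)

lemma transition_has_derivative:
  assumes "smoothly_compatible c s" "q \<in> chart_dom c" "q \<in> chart_dom s"
  shows "(transition s c has_derivative frechet_derivative (transition s c) (at (coord s q))) (at (coord s q))"
    and "(transition c s has_derivative frechet_derivative (transition c s) (at (coord c q))) (at (coord c q))"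
  using assms by (auto simp: smoothly_compatible_def intro: smooth_on_has_derivative)

text \<open>Chain rule for a composition that is the identity on the open overlap. It lets any
  vector be written as the image of its components in the slice chart.\<close>

lemma transition_derivative_inverse:
  assumes "is_chart c" "is_chart s" "smoothly_compatible c s" "q \<in> chart_dom c" "q \<in> chart_dom s"
  shows "frechet_derivative (transition s c) (at (coord s q))
    (frechet_derivative (transition c s) (at (coord c q)) v) = v"
proof -
  let ?J = "frechet_derivative (transition s c) (at (coord s q))"
  let ?K = "frechet_derivative (transition c s) (at (coord c q))"
  let ?S = "coord c ` (chart_dom s \<inter> chart_dom c)"
  have "(transition s c \<circ> transition c s has_derivative ?J \<circ> ?K) (at (coord c q))"
    using assms transition_has_derivative[OF assms(3-5)]
    by (intro diff_chain_at) (simp_all add: transition_coord)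
  moreover have "open ?S"
    using assms by (intro open_coord_image) (simp_all add: is_chart_def)
  moreover have "coord c q \<in> ?S"
    using assms(4,5) by blast
  moreover have "(transition s c \<circ> transition c s) x = x" if "x \<in> ?S" for x
    using that assms by (auto simp: transition_coord)
  ultimately have "((\<lambda>x. x) has_derivative ?J \<circ> ?K) (at (coord c q))"
    by (rule has_derivative_transform_within_open)
  then have "?J \<circ> ?K = (\<lambda>x. x)"
    using has_derivative_unique has_derivative_ident by blast
  then show ?thesis by (metis comp_apply)
qed

section \<open>Slice charts and tangent vectors\<close>

lemma slice_mem:
  assumes "is_chart s" "coord s ` (H \<inter> chart_dom s) = {x \<in> coord s ` chart_dom s. x $ 0 = 0}"
    and "q \<in> chart_dom s"
  shows "q \<in> H \<longleftrightarrow> coord s q $ 0 = 0"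
proof
  assume "coord s q $ 0 = 0"
  then have "coord s q \<in> coord s ` (H \<inter> chart_dom s)"
    using assms by blast
  then obtain r where "r \<in> H" "r \<in> chart_dom s" "coord s q = coord s r"
    by blast
  then show "q \<in> H"
    using chart_inv_coord[OF assms(1)] assms(3) by metis
qed (use assms in blast)

text \<open>A straight segment in slice coordinates with direction \<open>w\<close> stays in the
  hyperplane \<open>x $ 0 = 0\<close>, hence in \<open>H\<close>; its velocity in the chart
  \<open>c\<close> is the required vector.\<close>

lemma tangent_space_slice:
  assumes c: "is_chart c" and s: "is_chart s" and cs: "smoothly_compatible c s"
    and H: "coord s ` (H \<inter> chart_dom s) = {x \<in> coord s ` chart_dom s. x $ 0 = 0}"
    and q: "q \<in> H" "q \<in> chart_dom c" "q \<in> chart_dom s" and w: "w $ 0 = 0"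
  shows "frechet_derivative (transition s c) (at (coord s q)) w \<in> tangent_space H c q"
proof -
  let ?S = "coord s ` (chart_dom c \<inter> chart_dom s)"
  define l where "l t = coord s q + t *\<^sub>R w" for t :: real
  have "open (l -` ?S)"
    unfolding l_def using c s
    by (intro open_vimage open_coord_image continuous_intros) (auto simp: is_chart_def)
  moreover have "0 \<in> l -` ?S"
    using q by (simp add: l_def)
  \<comment> \<open>The parameter range is cut down so that the segment stays in the overlap of both
    charts.\<close>
  ultimately obtain e where "e > 0" and e: "ball 0 e \<subseteq> l -` ?S"
    by (meson openE)
  have ball: "{-e<..<e} = ball 0 e"
    by (auto simp: dist_real_def)
  have l: "l t \<in> ?S" if "t \<in> {-e<..<e}" for t
    using that e ball by auto
  have coord: "coord c \<circ> (chart_inv s \<circ> l) = (\<lambda>t. transition s c (coord s q + t *\<^sub>R w))"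
    by (simp add: transition_def l_def fun_eq_iff)
  have "chart_inv s (l t) \<in> H \<inter> chart_dom c" if t: "t \<in> {-e<..<e}" for t
  proof -
    obtain r where r: "r \<in> chart_dom c" "r \<in> chart_dom s" "l t = coord s r"
      using l[OF t] by blast
    have "l t $ 0 = 0"
      using slice_mem[OF s H q(3)] q(1) w by (simp add: l_def)
    then show ?thesis
      using r slice_mem[OF s H r(2)] chart_inv_coord[OF s] by simp
  qed
  then have "(chart_inv s \<circ> l) ` {-e<..<e} \<subseteq> H \<inter> chart_dom c"
    by auto
  moreover have "smooth_on {-e<..<e} (coord c \<circ> (chart_inv s \<circ> l))"
    unfolding coord smooth_on_def
  proof
    fix n
    show "higher_differentiable_on {-e<..<e} (\<lambda>t. transition s c (coord s q + t *\<^sub>R w)) n"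
    proof (rule higher_differentiable_on_affine)
      show "coord s q + t *\<^sub>R w \<in> ?S" if "t \<in> {-e<..<e}" for t
        using l[OF that] by (simp add: l_def)
      show "higher_differentiable_on ?S (transition s c) n"
        using cs by (simp add: smoothly_compatible_def smooth_on_def)
    qed simp
  qed
  moreover have "(chart_inv s \<circ> l) 0 = q"
    using q chart_inv_coord[OF s] by (simp add: l_def)
  moreover have "((coord c \<circ> (chart_inv s \<circ> l)) has_vector_derivative
      frechet_derivative (transition s c) (at (coord s q)) w) (at 0)"
  proof -
    have "(l has_vector_derivative w) (at 0)"
      unfolding l_def by (auto intro!: derivative_eq_intros simp: has_vector_derivative_def)
    moreover have "(transition s c has_derivative frechet_derivative (transition s c) (at (coord s q)))
        (at (l 0))"
      using transition_has_derivative(1)[OF cs q(2,3)] by (simp add: l_def)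
    ultimately have "(transition s c \<circ> l has_vector_derivative
        frechet_derivative (transition s c) (at (coord s q)) w) (at 0)"
      using vector_derivative_diff_chain_within[of l w 0 UNIV] has_derivative_at_withinI by blast
    then show ?thesis
      by (simp add: transition_def comp_assoc)
  qed
  ultimately show ?thesis
    unfolding tangent_space_def using \<open>e > 0\<close> by blast
qed

section \<open>Normals of a null hypersurface\<close>

lemma metric_ip_linear:
  "metric_ip G (u + v) w = metric_ip G u w + metric_ip G v w"
  "metric_ip G (u - v) w = metric_ip G u w - metric_ip G v w"
  "metric_ip G (t *\<^sub>R u) w = t * metric_ip G u w"
  "metric_ip G u (v + w) = metric_ip G u v + metric_ip G u w"
  "metric_ip G u (t *\<^sub>R v) = t * metric_ip G u v"
  by (simp_all add: metric_ip_def algebra_simps inner_simps matrix_vector_right_distrib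
      matrix_vector_mult_scaleR)

lemma metric_ip_nondegenerate:
  assumes "invertible G" "\<And>w. metric_ip G u w = 0"
  shows "u = 0"
proof -
  \<comment> \<open>Raising the Euclidean covector \<open>u\<close> gives a test vector whose metric
    product with \<open>u\<close> is the positive definite \<open>u \<bullet> u\<close>.\<close>
  have "u = G *v (matrix_inv G *v u)"
    using assms(1) by (simp add: matrix_vector_mul_assoc matrix_inv_cancel)
  then have "metric_ip G u (matrix_inv G *v u) = u \<bullet> u"
    by (simp add: metric_ip_def)
  then show ?thesis using assms(2) by simp
qed

text \<open>The tangent space is 3-dimensional, so any two normals are proportional.\<close>

lemma normal_to_null_hypersurface_null:
  assumes c: "is_chart c" and s: "is_chart s" and cs: "smoothly_compatible c s"
    and H: "coord s ` (H \<inter> chart_dom s) = {x \<in> coord s ` chart_dom s. x $ 0 = 0}"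
    and q: "q \<in> H" "q \<in> chart_dom c" "q \<in> chart_dom s"
    and inv: "invertible (g c q)"
    and n: "n \<noteq> 0" "normal_at g H c q n" "metric_ip (g c q) n n = 0"
    and k: "normal_at g H c q k"
  shows "metric_ip (g c q) k k = 0"
proof -
  let ?J = "frechet_derivative (transition s c) (at (coord s q))"
  let ?K = "frechet_derivative (transition c s) (at (coord c q))"
  let ?ip = "metric_ip (g c q)"
  let ?e = "axis 0 1 :: real^4"
  have lin: "linear ?J"
    using transition_has_derivative(1)[OF cs q(2,3)] by (rule has_derivative_linear)
  \<comment> \<open>Modulo tangent vectors every \<open>v\<close> is a multiple of the single
    transversal vector \<open>?J ?e\<close>, so a normal is determined by its product with that
    vector.\<close>
  have J: "?ip m v = ?K v $ 0 * ?ip m (?J ?e)" if "normal_at g H c q m" for m v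
  proof -
    let ?w = "?K v - (?K v $ 0) *\<^sub>R ?e"
    have "?J ?w \<in> tangent_space H c q"
      by (rule tangent_space_slice[OF c s cs H q]) (simp add: axis_def)
    then have "?ip m (?J ?w) = 0"
      using that by (simp add: normal_at_def)
    moreover have "?J ?w + (?K v $ 0) *\<^sub>R ?J ?e = v"
      using transition_derivative_inverse[OF c s cs q(2,3), of v]
      by (simp add: linear_diff[OF lin] linear_scale[OF lin])
    ultimately show ?thesis
      using metric_ip_linear(4)[of "g c q" m "?J ?w" "(?K v $ 0) *\<^sub>R ?J ?e"]
      by (simp only: metric_ip_linear(5) add_0)
  qed
  define a where "a = ?ip n (?J ?e)"
  define b where "b = ?ip k (?J ?e)"
  have Jn: "?ip n v = ?K v $ 0 * a" and Jk: "?ip k v = ?K v $ 0 * b" for v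
    unfolding a_def b_def by (rule J[OF n(2)], rule J[OF k])
  \<comment> \<open>Otherwise \<open>n\<close> would be orthogonal to every vector and hence
    zero.\<close>
  have "a \<noteq> 0"
    using metric_ip_nondegenerate[OF inv, of n] Jn n(1) by auto
  have "a *\<^sub>R k - b *\<^sub>R n = 0"
    by (intro metric_ip_nondegenerate[OF inv]) (simp add: metric_ip_linear Jn Jk)
  then have eq: "a *\<^sub>R k = b *\<^sub>R n"
    by simp
  have "a * (a * ?ip k k) = ?ip (a *\<^sub>R k) (a *\<^sub>R k)"
    by (simp add: metric_ip_linear)
  also have "\<dots> = 0"
    unfolding eq by (simp add: metric_ip_linear n(3))
  finally show ?thesis
    using \<open>a \<noteq> 0\<close> by simp
qed

lemma killing_horizon_null:
  assumes "oriented_atlas A" "killing_horizon A g k H" "c \<in> A" "q \<in> H" "q \<in> chart_dom c"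
    and "invertible (g c q)"
  shows "metric_ip (g c q) (k c q) (k c q) = 0"
proof -
  have c: "is_chart c"
    using assms by (simp add: oriented_atlas_def)
  have hyp: "hypersurface A H"
    using assms(2) by (simp add: killing_horizon_def null_hypersurface_def)
  obtain s where s: "is_chart s" "q \<in> chart_dom s" "smoothly_compatible c s"
      "coord s ` (H \<inter> chart_dom s) = {x \<in> coord s ` chart_dom s. x $ 0 = 0}"
    using hyp assms(3,4) unfolding hypersurface_def by meson
  obtain n where n: "n \<noteq> 0" "normal_at g H c q n" "metric_ip (g c q) n n = 0"
    using assms(2-5) unfolding killing_horizon_def null_hypersurface_def by blast
  have "normal_at g H c q (k c q)"
    using assms(2-5) by (simp add: killing_horizon_def)
  then show ?thesis
    using normal_to_null_hypersurface_null[OF c s(1,3,4) assms(4,5) s(2) assms(6) n] by blast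
qed

text \<open>On a connected set local constancy suffices. In a slice chart, nearby points of
  \<open>H\<close> are joined by straight coordinate segments inside \<open>H\<close>, along which
  the derivative of \<open>f\<close> vanishes.\<close>

lemma constant_on_components_hypersurface:
  assumes A: "\<And>c. c \<in> A \<Longrightarrow> is_chart c" and hyp: "hypersurface A H"
    and f: "has_differential A U f \<alpha>" and U: "open U" "H \<subseteq> U"
    and zero: "\<And>c q v. c \<in> A \<Longrightarrow> q \<in> H \<Longrightarrow> q \<in> chart_dom c \<Longrightarrow> v \<in> tangent_space H c q
      \<Longrightarrow> \<alpha> c q \<bullet> v = 0"
    and C: "C \<in> components H"
  shows "f constant_on C"
proof (rule locally_constant_imp_constant)
  show "connected C"
    using C by (rule in_components_connected)
next
  fix p assume "p \<in> C"
  then have p: "p \<in> H"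
    using C in_components_subset by blast
  obtain s where s: "is_chart s" "p \<in> chart_dom s" "\<And>c. c \<in> A \<Longrightarrow> smoothly_compatible c s"
      and slice: "coord s ` (H \<inter> chart_dom s) = {x \<in> coord s ` chart_dom s. x $ 0 = 0}"
    using hyp p unfolding hypersurface_def by meson
  let ?x = "coord s p"
  have "open (coord s ` (U \<inter> chart_dom s))"
    using s(1) U(1) by (rule open_coord_image)
  moreover have "?x \<in> coord s ` (U \<inter> chart_dom s)"
    using p s(2) U(2) by blast
  \<comment> \<open>A ball is used because it is convex: it contains the whole segment from
    \<open>?x\<close> to the coordinates of any of its points.\<close>
  ultimately obtain e where "e > 0" and e: "ball ?x e \<subseteq> coord s ` (U \<inter> chart_dom s)"
    by (meson openE)
  define N where "N = coord s -` ball ?x e \<inter> chart_dom s"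
  have "open N"
    using s(1) unfolding N_def is_chart_def homeomorphism_def
    by (metis continuous_on_open_vimage open_ball)
  moreover have "p \<in> N"
    using s(2) \<open>e > 0\<close> by (simp add: N_def)
  moreover have "f r = f p" if r: "r \<in> C" "r \<in> N" for r
  proof -
    have "r \<in> H" "r \<in> chart_dom s" and r_ball: "coord s r \<in> ball ?x e"
      using r C in_components_subset by (auto simp: N_def)
    define w where "w = coord s r - ?x"
    define l where "l t = ?x + t *\<^sub>R w" for t :: real
    have w0: "w $ 0 = 0"
      using slice_mem[OF s(1) slice] \<open>r \<in> H\<close> \<open>r \<in> chart_dom s\<close> p s(2) by (simp add: w_def)
    have "((\<lambda>t. f (chart_inv s (l t))) has_derivative (\<lambda>h. 0)) (at t within {0..1})"
      if t: "t \<in> {0..1}" for t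
    proof -
      have "norm (t *\<^sub>R w) \<le> norm w"
        using t by (simp add: mult_left_le_one_le)
      then have "l t \<in> ball ?x e"
        using r_ball by (simp add: l_def w_def dist_norm norm_minus_commute)
      then obtain q where q: "q \<in> U" "q \<in> chart_dom s" "l t = coord s q"
        using e by blast
      have "l t $ 0 = 0"
        using slice_mem[OF s(1) slice s(2)] p w0 by (simp add: l_def)
      then have "q \<in> H"
        using slice_mem[OF s(1) slice q(2)] q(3) by simp
      \<comment> \<open>The slice chart need not belong to \<open>A\<close>, so the differential of
        \<open>f\<close> is available only in a chart \<open>c\<close> of the atlas, chosen anew for
        each point of the segment. The transition map carries it back to slice coordinates.\<close>
      then obtain c where c: "c \<in> A" "q \<in> chart_dom c"
        using hyp unfolding hypersurface_def carrier_def by blast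
      let ?J = "frechet_derivative (transition s c) (at (coord s q))"
      let ?S = "coord s ` (chart_dom c \<inter> chart_dom s)"
      have J: "(transition s c has_derivative ?J) (at (coord s q))"
        using transition_has_derivative(1)[OF s(3)[OF c(1)] c(2) q(2)] .
      have "((f \<circ> chart_inv c) has_derivative (\<lambda>v. \<alpha> c q \<bullet> v)) (at (transition s c (coord s q)))"
        using f c q s(1) by (simp add: has_differential_def transition_coord)
      from diff_chain_at[OF J this]
      have "((f \<circ> chart_inv c) \<circ> transition s c has_derivative (\<lambda>v. \<alpha> c q \<bullet> ?J v)) (at (coord s q))"
        by (simp add: o_def)
      moreover have "open ?S"
        using A[OF c(1)] s(1) by (intro open_coord_image) (simp_all add: is_chart_def)
      moreover have "coord s q \<in> ?S"
        using c q by blast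
      moreover have "((f \<circ> chart_inv c) \<circ> transition s c) x = f (chart_inv s x)" if "x \<in> ?S" for x
        using that chart_inv_coord[OF s(1)] chart_inv_coord[OF A[OF c(1)]]
        by (auto simp: transition_def)
      ultimately have "((\<lambda>x. f (chart_inv s x)) has_derivative (\<lambda>v. \<alpha> c q \<bullet> ?J v)) (at (l t))"
        unfolding q(3) by (rule has_derivative_transform_within_open)
      moreover have "(l has_derivative (\<lambda>h. h *\<^sub>R w)) (at t)"
        unfolding l_def by (auto intro!: derivative_eq_intros)
      ultimately have "((\<lambda>t. f (chart_inv s (l t))) has_derivative (\<lambda>h. \<alpha> c q \<bullet> ?J (h *\<^sub>R w))) (at t)"
        using diff_chain_at[of l] by (fastforce simp: o_def)
      moreover have "\<alpha> c q \<bullet> ?J (h *\<^sub>R w) = 0" for h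
        using zero[OF c(1) \<open>q \<in> H\<close> c(2)]
          tangent_space_slice[OF A[OF c(1)] s(1) s(3)[OF c(1)] slice \<open>q \<in> H\<close> c(2) q(2)] w0
        by simp
      ultimately show ?thesis
        by (simp add: has_derivative_at_withinI)
    qed
    then obtain b where "\<And>t. t \<in> {0..1} \<Longrightarrow> f (chart_inv s (l t)) = b"
      using has_derivative_zero_constant[of "{0..1::real}" "\<lambda>t. f (chart_inv s (l t))"] by auto
    \<comment> \<open>The parameters 0 and 1 correspond to \<open>p\<close> and
      \<open>r\<close>.\<close>
    from this[of 0] this[of 1] show ?thesis
      using chart_inv_coord[OF s(1)] s(2) \<open>r \<in> chart_dom s\<close> by (simp add: l_def w_def)
  qed
  ultimately show "\<exists>T. openin (top_of_set C) T \<and> p \<in> T \<and> (\<forall>x\<in>T. f x = f p)"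
    using \<open>p \<in> C\<close> openin_open_Int[of N C] by blast
qed

theorem theorem5:
  fixes A :: "('m::{t2_space, second_countable_topology}) chart set"
    and g F :: "('m, real^4^4) tensor_field"
    and k Je Jm :: "('m, real^4) tensor_field"
    and H D U :: "'m set"
    and \<Phi> \<Psi> :: "'m \<Rightarrow> real"
  assumes static: "static_spacetime A g k"
    and horizon: "killing_horizon A g k H"
    and regular: "open D" "D \<subseteq> carrier A" "H \<subseteq> D"
    and maxwell: "maxwell_solution A g D F Je Jm"
    and invariant: "invariant_under A D k F"
    and staticity: "wedge_vanishes A g D F k \<or> wedge_vanishes A g D (hodge2_field g F) k"
    and nbhd: "open U" "H \<subseteq> U" "U \<subseteq> D"
    and \<Phi>: "electric_potential A U k F \<Phi>"
    and \<Psi>: "magnetic_potential A g U k F \<Psi>"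
  shows "\<forall>C\<in>components H. \<Phi> constant_on C \<and> \<Psi> constant_on C"
proof -
  have atlas: "oriented_atlas A"
    using static by (simp add: static_spacetime_def spacetime_def)
  have hyp: "hypersurface A H"
    using horizon by (simp add: killing_horizon_def null_hypersurface_def)
  \<comment> \<open>Under either staticity condition one of the two contractions vanishes outright
    and the other vanishes on tangent vectors.\<close>
  have tangential: "contract2 (k c q) (F c q) \<bullet> v = 0 \<and> contract2 (k c q) (hodge2_field g F c q) \<bullet> v = 0"
    if c: "c \<in> A" and q: "q \<in> H" "q \<in> chart_dom c" and v: "v \<in> tangent_space H c q" for c q v
  proof -
    have L: "lorentzian (g c q)"
      using static c q by (simp add: static_spacetime_def spacetime_def lorentzian_metric_def)
    then have sym: "transpose (g c q) = g c q"
      by (simp add: lorentzian_def)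
    note inv = lorentzian_invertible[OF L]
    have null: "metric_ip (g c q) (k c q) (k c q) = 0"
      using killing_horizon_null[OF atlas horizon c q inv] .
    have orth: "metric_ip (g c q) (k c q) v = 0"
      using horizon c q v by (simp add: killing_horizon_def normal_at_def)
    have skew: "transpose (F c q) = - F c q"
      using maxwell c q regular(3) by (auto simp: maxwell_solution_def two_form_def)
    from staticity show ?thesis
    proof
      assume "wedge_vanishes A g D F k"
      then have "wedge21 (F c q) (lower (g c q) (k c q)) = 0"
        using c q regular(3) by (auto simp: wedge_vanishes_def flat_field_def)
      then show ?thesis
        using contract2_orthogonal[OF inv sym skew _ null orth] contract2_hodge2_zero[OF inv skew]
        by (simp add: hodge2_field_def)
    next
      assume "wedge_vanishes A g D (hodge2_field g F) k"
      then have "wedge21 (hodge2 (g c q) (F c q)) (lower (g c q) (k c q)) = 0"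
        using c q regular(3) by (auto simp: wedge_vanishes_def flat_field_def hodge2_field_def)
      then show ?thesis
        \<comment> \<open>Here *F takes the place of F in the orthogonality argument, being skew as
          well.\<close>
        using contract2_orthogonal[OF inv sym skew_hodge2 _ null orth]
          contract2_zero_of_hodge2[OF inv sym skew]
        by (simp add: hodge2_field_def)
    qed
  qed
  have charts: "is_chart c" if "c \<in> A" for c
    using atlas that by (simp add: oriented_atlas_def)
  show ?thesis
  proof (intro ballI conjI)
    fix C assume C: "C \<in> components H"
    show "\<Phi> constant_on C"
      using constant_on_components_hypersurface[OF charts hyp \<Phi>[unfolded electric_potential_def] nbhd(1,2) _ C]
        tangential by (simp add: inner_minus_left)
    show "\<Psi> constant_on C"
      using constant_on_components_hypersurface[OF charts hyp \<Psi>[unfolded magnetic_potential_def] nbhd(1,2) _ C]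
        tangential by simp
  qed
qed
end
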